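(* Let $p\ge3$ be an integer, let $A$ be a fixed zero-diagonal representative of an $\mathrm{SBIBD}(v,k,\lambda)$, and let $k\ge\lambda(p-1)+1$. If $A$ contains no pairwise separated set of size $p$, then $$\max\{p,\lambda+1\}\le q^*(A,p)\le\lambda(p-1)+1.$$ In particular, if $\lambda=1$, then $q^*(A,p)=p$.
   Context: Symmetric design. For integers $1\le\lambda<k<v$, an $\mathrm{SBIBD}(v,k,\lambda)$ consists of $v$ points and $v$ blocks such that every block contains $k$ points, every point lies in $k$ blocks, and every two distinct points lie together in exactly $\lambda$ blocks. After independently labeling points and blocks by $0,1,\dots,v-1$, the incidence matrix $A=(A_{ij})\in\{0,1\}^{v\times v}$, with $A_{ij}=1$ iff point $i$ lies in block $j$, is called a representative of the SBIBD. It is zero-diagonal if $A_{ii}=0$ for all $i$. Coding model. There are $v$ nodes $0,\dots,v-1$. For a node $i$ let $\mathcal S_{\mathrm{tgt}}(i)=\{j:A_{ij}=1\}$ (admissible targets) and $\mathcal S_{\mathrm{src}}(i)=\{h:A_{hi}=1\}$ (sources); both have size $k$. There is a finite collection of data objects, each a binary word of one common positive length; $\oplus$ is componentwise addition over $\mathbb F_2$. Each object $x$ has exactly one primary copy, stored at its primary node $i$, and for the replica count $q\in\{0,\dots,k\}$ it selects a set $T_x\subseteq\mathcal S_{\mathrm{tgt}}(i)$ of exactly $q$ distinct target nodes (chosen separately for each object) and sends one replica to each node in $T_x$. A placement is legal if at each node $j$ the replicas received at $j$ are partitioned into $k$-tuples, each containing exactly one replica from every primary node in $\mathcal S_{\mathrm{src}}(j)$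 (the partition is part of the placement). For each such tuple, consisting of objects $x_1,\dots,x_k$, node $j$ stores one parity $x_1\oplus\cdots\oplus x_k$; the replicas are then discarded. Failures and recovery. Given a set $F$ of failed nodes, all primary copies and parities stored at nodes of $F$ are lost, and those stored at other nodes are alive. A placement permits recovery from $F$ if the values of all objects whose primary node is in $F$ are uniquely determined by the alive primary copies and the alive parities (the placement being known). Universal replica threshold. For an integer $p\ge1$, $q^*(A,p)$ is the smallest integer $q\in\{0,1,\dots,k\}$ such that every legal placement of any finite object collection using exactly $q$ target nodes per object permits recovery from every set of at most $p$ failed nodes. (That such a $q$ exists is part of the asserted upper bound.) Pairwise separated set. For $F\subseteq\{0,\dots,v-1\}$ and $t\in\{0,\dots,v-1\}$ let $d_F(t)=\sum_{i\in F}A_{it}$. The set $F$ is pairwise separated if $d_F(t)\le2$ for every $t\in\{0,\dots,v-1\}$. *)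

theory Defs
  imports "Jordan_Normal_Form.Matrix" "HOL-Library.Z2" "HOL-Library.Disjoint_Sets"
begin

(* Blocks are an indexed family with an incidence relation, so that repeated blocks are
   not excluded by the encoding. *)
locale sbibd =
  fixes points :: "'a set" and blocks :: "'b set" and inc :: "'a \<Rightarrow> 'b \<Rightarrow> bool"
    and v k lam :: nat
  assumes params: "1 \<le> lam" "lam < k" "k < v"
    and card_points: "card points = v"
    and card_blocks: "card blocks = v"
    and block_size: "\<And>b. b \<in> blocks \<Longrightarrow> card {x \<in> points. inc x b} = k"
    and point_degree: "\<And>x. x \<in> points \<Longrightarrow> card {b \<in> blocks. inc x b} = k"
    and pair_degree: "\<And>x y. x \<in> points \<Longrightarrow> y \<in> points \<Longrightarrow> x \<noteq> y \<Longrightarrow>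
      card {b \<in> blocks. inc x b \<and> inc y b} = lam"

definition representative ::
    "nat mat \<Rightarrow> 'a set \<Rightarrow> 'b set \<Rightarrow> ('a \<Rightarrow> 'b \<Rightarrow> bool) \<Rightarrow> nat \<Rightarrow> bool" where
  "representative A points blocks inc v \<longleftrightarrow>
    (\<exists>pt bl. bij_betw pt {..<v} points \<and> bij_betw bl {..<v} blocks \<and>
      A = mat v v (\<lambda>(i, j). if inc (pt i) (bl j) then 1 else 0))"

definition zero_diagonal :: "nat mat \<Rightarrow> bool" where
  "zero_diagonal A \<longleftrightarrow> (\<forall>i < dim_row A. A $$ (i, i) = 0)"

definition tgt :: "nat mat \<Rightarrow> nat \<Rightarrow> nat set" where
  "tgt A i = {j. j < dim_col A \<and> A $$ (i, j) = 1}"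

definition src :: "nat mat \<Rightarrow> nat \<Rightarrow> nat set" where
  "src A i = {h. h < dim_row A \<and> A $$ (h, i) = 1}"

(* Objects are given by natural-number labels; their values, the binary words, are not part
   of the placement.  tuples j is the partition of the replicas received at node j; a
   replica received at j is identified with its object, because targets x is a set and so
   an object has at most one replica at j. *)
record placement =
  objects :: "nat set"
  primary :: "nat \<Rightarrow> nat"
  targets :: "nat \<Rightarrow> nat set"
  tuples :: "nat \<Rightarrow> nat set set"

definition received :: "placement \<Rightarrow> nat \<Rightarrow> nat set" where
  "received P j = {x \<in> objects P. j \<in> targets P x}"

definition legal_placement :: "nat mat \<Rightarrow> nat \<Rightarrow> nat \<Rightarrow> placement \<Rightarrow> bool" where
  "legal_placement A k q P \<longleftrightarrow>
    finite (objects P) \<and>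
    (\<forall>x \<in> objects P. primary P x < dim_row A \<and>
      targets P x \<subseteq> tgt A (primary P x) \<and> card (targets P x) = q) \<and>
    (\<forall>j < dim_row A. partition_on (received P j) (tuples P j) \<and>
      (\<forall>t \<in> tuples P j. card t = k \<and>
        (\<forall>h \<in> src A j. \<exists>!x. x \<in> t \<and> primary P x = h)))"

definition parity :: "nat \<Rightarrow> (nat \<Rightarrow> bit vec) \<Rightarrow> nat set \<Rightarrow> bit vec" where
  "parity L w t = vec L (\<lambda>l. \<Sum>x \<in> t. w x $ l)"

(* Two assignments w, w' of words of length L to the objects that agree on everything alive
   must agree on every object whose primary node failed. *)
definition permits_recovery :: "nat mat \<Rightarrow> nat \<Rightarrow> placement \<Rightarrow> nat set \<Rightarrow> bool" where
  "permits_recovery A L P F \<longleftrightarrow>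
    (\<forall>w w'.
      (\<forall>x \<in> objects P. w x \<in> carrier_vec L \<and> w' x \<in> carrier_vec L) \<and>
      (\<forall>x \<in> objects P. primary P x \<notin> F \<longrightarrow> w x = w' x) \<and>
      (\<forall>j < dim_row A. j \<notin> F \<longrightarrow> (\<forall>t \<in> tuples P j. parity L w t = parity L w' t))
      \<longrightarrow> (\<forall>x \<in> objects P. primary P x \<in> F \<longrightarrow> w x = w' x))"

definition universal_count :: "nat mat \<Rightarrow> nat \<Rightarrow> nat \<Rightarrow> nat \<Rightarrow> bool" where
  "universal_count A k p q \<longleftrightarrow>
    (\<forall>L P F. 0 < L \<longrightarrow> legal_placement A k q P \<longrightarrow> F \<subseteq> {..<dim_row A} \<longrightarrow> card F \<le> p \<longrightarrow>
      permits_recovery A L P F)"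

(* Only meaningful if some universal count q \<le> k exists. *)
definition q_star :: "nat mat \<Rightarrow> nat \<Rightarrow> nat \<Rightarrow> nat" where
  "q_star A k p = (LEAST q. q \<le> k \<and> universal_count A k p q)"

definition d :: "nat mat \<Rightarrow> nat set \<Rightarrow> nat \<Rightarrow> nat" where
  "d A F t = (\<Sum>i \<in> F. A $$ (i, t))"

definition pairwise_separated :: "nat mat \<Rightarrow> nat set \<Rightarrow> bool" where
  "pairwise_separated A F \<longleftrightarrow> F \<subseteq> {..<dim_row A} \<and> (\<forall>t < dim_col A. d A F t \<le> 2)"

end

theory Submission
  imports Defs
begin

text \<open>
  Upper bound.  Let \<open>U\<close> be the set of objects on which two indistinguishable value assignments
  differ; all have their primary node in \<open>F\<close>.  Let \<open>n i\<close> count those at \<open>i\<close>.  In an alive tuple a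
  member of \<open>U\<close> never stands alone, so at an alive column the replicas from \<open>i\<close> number at most
  \<open>\<Sum>h. min (n i) (n h)\<close>, summed over the other nodes of \<open>F\<close> in that column.  Adding up all replicas of
  \<open>U\<close> and splitting into level sets \<open>G = {i. n i > s}\<close> reduces the claim to the inequality
  \<open>\<Sum>\<^bsub>j \<notin> F\<^esub> d\<^sub>G(j) (d\<^sub>G(j) - 1) + \<Sum>\<^bsub>j \<in> F\<^esub> d\<^sub>G(j) \<le> (\<lambda>(p - 1) + 1) |G|\<close>, which follows from
  \<open>x \<le> x(x - 1) + 1\<close> and is strict unless \<open>G = F\<close> and \<open>|F| = p\<close> (for a singleton \<open>G\<close>
  because the diagonal is zero).  In that remaining case \<open>n\<close> is
  constant on \<open>F\<close>, and a column that meets \<open>F\<close> at least three times makes the count strict.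

  Lower bound.  In a cyclic placement the \<open>q\<close> targets of one object can be any \<open>q\<close> admissible targets;
  for \<open>q < p\<close> all of them can fail together with its primary node.  For \<open>q \<le> \<lambda>\<close>, two failed nodes
  own objects with the same targets, all of them common to both nodes, that meet in every tuple.
\<close>

section \<open>Level-set sums and modular cancellation\<close>

lemma sum_level_sets:
  fixes n :: "'i \<Rightarrow> nat"
  assumes "finite B" and "\<And>i. i \<in> B \<Longrightarrow> n i \<le> M"
  shows "(\<Sum>i\<in>B. n i) = (\<Sum>s<M. card {i \<in> B. s < n i})"
proof -
  have "(\<Sum>s<M. card {i \<in> B. s < n i}) = (\<Sum>s<M. \<Sum>i\<in>B. if s < n i then 1 else 0)"
    using assms(1) by (simp add: sum.If_cases Int_def)
  also have "\<dots> = (\<Sum>i\<in>B. \<Sum>s<M. if s < n i then 1 else 0)"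
    by (rule sum.swap)
  also have "\<dots> = (\<Sum>i\<in>B. n i)"
  proof (rule sum.cong[OF refl])
    fix i assume "i \<in> B"
    then have "{..<M} \<inter> {s. s < n i} = {..<n i}" using assms(2)[of i] by auto
    then show "(\<Sum>s<M. if s < n i then 1 else 0) = n i" by (simp add: sum.If_cases)
  qed
  finally show ?thesis ..
qed

text \<open>The value \<open>min (n i) (n h)\<close> exceeds \<open>s\<close> exactly when
  \<open>i\<close> and \<open>h\<close> both lie in the level set at \<open>s\<close>. Hence each
  level contributes its ordered pairs of distinct elements.\<close>

lemma sum_min_level_sets:
  fixes n :: "'i \<Rightarrow> nat"
  assumes fin: "finite B" and M: "\<And>i. i \<in> B \<Longrightarrow> n i \<le> M"
  shows "(\<Sum>i\<in>B. \<Sum>h\<in>B - {i}. min (n i) (n h)) =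
    (\<Sum>s<M. card {i \<in> B. s < n i} * (card {i \<in> B. s < n i} - 1))"
proof -
  have "(\<Sum>i\<in>B. \<Sum>h\<in>B - {i}. min (n i) (n h))
      = (\<Sum>i\<in>B. \<Sum>s<M. card {h \<in> B - {i}. s < min (n i) (n h)})"
    using fin M by (intro sum.cong refl sum_level_sets) (auto simp: min_le_iff_disj)
  also have "\<dots> = (\<Sum>s<M. \<Sum>i\<in>B. card {h \<in> B - {i}. s < min (n i) (n h)})"
    by (rule sum.swap)
  also have "\<dots> = (\<Sum>s<M. card {i \<in> B. s < n i} * (card {i \<in> B. s < n i} - 1))"
  proof (rule sum.cong[OF refl])
    fix s
    let ?G = "{i \<in> B. s < n i}"
    have "(\<Sum>i\<in>B. card {h \<in> B - {i}. s < min (n i) (n h)})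
        = (\<Sum>i\<in>B. if s < n i then card ?G - 1 else 0)"
    proof (rule sum.cong[OF refl])
      fix i assume i: "i \<in> B"
      have "{h \<in> B - {i}. s < min (n i) (n h)} = (if s < n i then ?G - {i} else {})" by auto
      then show "card {h \<in> B - {i}. s < min (n i) (n h)} = (if s < n i then card ?G - 1 else 0)"
        using i fin by (simp add: card_Diff_singleton_if)
    qed
    also have "\<dots> = card ?G * (card ?G - 1)"
      using fin by (simp add: sum.If_cases Int_def)
    finally show "(\<Sum>i\<in>B. card {h \<in> B - {i}. s < min (n i) (n h)}) = card ?G * (card ?G - 1)" .
  qed
  finally show ?thesis .
qed

text \<open>Truncation at \<open>a\<close> does no harm: if some \<open>n h\<close> reaches
  \<open>a\<close>, that single term already dominates \<open>x\<close>; otherwise every minimum is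
  \<open>n h\<close> itself.\<close>

lemma le_sum_min:
  fixes n :: "'i \<Rightarrow> nat"
  assumes "finite B" and "x \<le> a" and "x \<le> (\<Sum>h\<in>B. n h)"
  shows "x \<le> (\<Sum>h\<in>B. min a (n h))"
proof (cases "\<exists>h\<in>B. a \<le> n h")
  case True
  then obtain h where h: "h \<in> B" "a \<le> n h" by blast
  have "min a (n h) \<le> (\<Sum>h\<in>B. min a (n h))"
    using h assms(1) by (intro member_le_sum) auto
  then show ?thesis using h assms(2) by simp
next
  case False
  then have "(\<Sum>h\<in>B. min a (n h)) = (\<Sum>h\<in>B. n h)" by (intro sum.cong) auto
  then show ?thesis using assms(3) by simp
qed

lemma mod_add_cancel_less:
  fixes s r r' k :: nat
  assumes "(s + r) mod k = (s + r') mod k" "r < k" "r' < k"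
  shows "r = r'"
  using assms
proof (induction r r' rule: linorder_wlog)
  case (le r r')
  then have "k dvd (s + r') - (s + r)"
    by (metis mod_eq_dvd_iff_nat nat_add_left_cancel_le)
  then show ?case using le by (auto dest!: dvd_imp_le)
qed simp

section \<open>Incidence matrices of symmetric designs\<close>

text \<open>Restates the design through rows and columns of \<open>A\<close>, so that points, blocks
  and their labelings disappear from the counting.\<close>

locale incidence_matrix =
  fixes A :: "nat mat" and v k lam :: nat
  assumes dim: "dim_row A = v" "dim_col A = v"
    and params: "1 \<le> lam" "lam < k" "k < v"
    and zero_one: "\<And>i j. i < v \<Longrightarrow> j < v \<Longrightarrow> A $$ (i, j) = 0 \<or> A $$ (i, j) = 1"
    and diag: "\<And>i. i < v \<Longrightarrow> A $$ (i, i) = 0"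
    and card_tgt: "\<And>i. i < v \<Longrightarrow> card (tgt A i) = k"
    and card_src: "\<And>j. j < v \<Longrightarrow> card (src A j) = k"
    and card_common_tgt: "\<And>i h. i < v \<Longrightarrow> h < v \<Longrightarrow> i \<noteq> h \<Longrightarrow> card (tgt A i \<inter> tgt A h) = lam"

lemma incidence_matrix_of_representative:
  fixes A :: "nat mat"
  assumes "sbibd points blocks inc v k lam"
    and "representative A points blocks inc v"
    and "zero_diagonal A"
  shows "incidence_matrix A v k lam"
proof -
  interpret sbibd points blocks inc v k lam by fact
  obtain pt bl where pt: "bij_betw pt {..<v} points" and bl: "bij_betw bl {..<v} blocks"
    and A: "A = mat v v (\<lambda>(i, j). if inc (pt i) (bl j) then 1 else 0)"
    using assms(2) by (auto simp: representative_def)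
  have pt_in: "pt i \<in> points" if "i < v" for i
    using pt that by (auto simp: bij_betw_def)
  have bl_in: "bl i \<in> blocks" if "i < v" for i
    using bl that by (auto simp: bij_betw_def)
  have tgt: "tgt A i = {j \<in> {..<v}. inc (pt i) (bl j)}" if "i < v" for i
    using that by (auto simp: tgt_def A split: if_splits)
  have src: "src A j = {i \<in> {..<v}. inc (pt i) (bl j)}" if "j < v" for j
    using that by (auto simp: src_def A split: if_splits)
  have card_bl: "card {j \<in> {..<v}. Q (bl j)} = card {b \<in> blocks. Q b}" for Q
  proof (rule bij_betw_same_card)
    show "bij_betw bl {j \<in> {..<v}. Q (bl j)} {b \<in> blocks. Q b}"
      using bl by (auto simp: bij_betw_def inj_on_def)
  qed
  have card_pt: "card {j \<in> {..<v}. Q (pt j)} = card {b \<in> points. Q b}" for Q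
  proof (rule bij_betw_same_card)
    show "bij_betw pt {j \<in> {..<v}. Q (pt j)} {b \<in> points. Q b}"
      using pt by (auto simp: bij_betw_def inj_on_def)
  qed
  show ?thesis
  proof
    show "dim_row A = v" "dim_col A = v" by (auto simp: A)
    show "1 \<le> lam" "lam < k" "k < v" by (fact params)+
    show "A $$ (i, j) = 0 \<or> A $$ (i, j) = 1" if "i < v" "j < v" for i j
      using that by (auto simp: A)
    show "A $$ (i, i) = 0" if "i < v" for i
      using assms(3) that by (auto simp: zero_diagonal_def A)
    show "card (tgt A i) = k" if "i < v" for i
      using tgt[OF that] card_bl[of "inc (pt i)"] point_degree[OF pt_in[OF that]] by simp
    show "card (src A j) = k" if "j < v" for j
      using src[OF that] card_pt[of "\<lambda>x. inc x (bl j)"] block_size[OF bl_in[OF that]] by simp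
    show "card (tgt A i \<inter> tgt A h) = lam" if "i < v" "h < v" "i \<noteq> h" for i h
    proof -
      have "pt i \<noteq> pt h"
        using pt that by (auto simp: bij_betw_def inj_on_def)
      moreover have "tgt A i \<inter> tgt A h = {j \<in> {..<v}. inc (pt i) (bl j) \<and> inc (pt h) (bl j)}"
        using tgt that by auto
      ultimately show ?thesis
        using card_bl[of "\<lambda>b. inc (pt i) b \<and> inc (pt h) b"] pair_degree pt_in that by simp
    qed
  qed
qed

context incidence_matrix
begin

lemma tgt_subset: "tgt A i \<subseteq> {..<v}"
  by (auto simp: tgt_def dim)

lemma finite_tgt: "finite (tgt A i)"
  using tgt_subset finite_subset by blast

lemma finite_src: "finite (src A j)"
  by (auto simp: src_def)

lemma mem_tgt_iff_mem_src: "i < v \<Longrightarrow> j < v \<Longrightarrow> j \<in> tgt A i \<longleftrightarrow> i \<in> src A j"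
  by (auto simp: tgt_def src_def dim)

lemma d_eq_card:
  assumes "F \<subseteq> {..<v}" "t < v"
  shows "d A F t = card (F \<inter> src A t)"
proof -
  have "finite F" using assms finite_subset by blast
  have "d A F t = (\<Sum>i\<in>F. if i \<in> src A t then 1 else 0)"
    unfolding d_def
  proof (rule sum.cong)
    fix i assume "i \<in> F"
    then show "A $$ (i, t) = (if i \<in> src A t then 1 else 0)"
      using zero_one[of i t] assms by (auto simp: src_def dim)
  qed simp
  then show ?thesis
    using \<open>finite F\<close> by (simp add: sum.If_cases)
qed

text \<open>Double counting of triples \<open>(i, h, j)\<close> with \<open>i\<close>,
  \<open>h\<close> distinct in \<open>G\<close> and column \<open>j\<close> a common target: columns
  give the left side, and each ordered pair has \<open>lam\<close> common targets.\<close>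

lemma sum_d_pairs:
  assumes G: "G \<subseteq> {..<v}"
  shows "(\<Sum>j<v. card (G \<inter> src A j) * (card (G \<inter> src A j) - 1)) = lam * (card G * (card G - 1))"
proof -
  have fin: "finite G" using G finite_subset by blast
  have "(\<Sum>j<v. card (G \<inter> src A j) * (card (G \<inter> src A j) - 1))
      = (\<Sum>j<v. \<Sum>i\<in>G \<inter> src A j. card (G \<inter> src A j - {i}))"
    by (intro sum.cong refl) (simp add: card_Diff_singleton_if)
  also have "\<dots> = (\<Sum>j<v. \<Sum>i\<in>G. \<Sum>h\<in>G - {i}. if j \<in> tgt A i \<inter> tgt A h then 1 else 0)"
  proof (rule sum.cong[OF refl])
    fix j assume "j \<in> {..<v}"
    then have j: "j < v" by simp
    have mem: "j \<in> tgt A i \<longleftrightarrow> i \<in> src A j" if "i \<in> G" for i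
      using that G j mem_tgt_iff_mem_src by auto
    have "(\<Sum>i\<in>G. \<Sum>h\<in>G - {i}. if j \<in> tgt A i \<inter> tgt A h then 1 else (0::nat))
        = (\<Sum>i\<in>G. if i \<in> src A j then card (G \<inter> src A j - {i}) else 0)"
    proof (intro sum.cong refl)
      fix i assume i: "i \<in> G"
      have "(\<Sum>h\<in>G - {i}. if j \<in> tgt A i \<inter> tgt A h then 1 else (0::nat))
          = card {h \<in> G - {i}. i \<in> src A j \<and> h \<in> src A j}"
        using fin i by (simp add: sum.If_cases mem Int_def cong: conj_cong)
      also have "\<dots> = (if i \<in> src A j then card (G \<inter> src A j - {i}) else 0)"
        by (auto intro!: arg_cong[where f = card])
      finally show "(\<Sum>h\<in>G - {i}. if j \<in> tgt A i \<inter> tgt A h then 1 else (0::nat))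
          = (if i \<in> src A j then card (G \<inter> src A j - {i}) else 0)" .
    qed
    also have "\<dots> = (\<Sum>i\<in>G \<inter> src A j. card (G \<inter> src A j - {i}))"
      by (rule sum.inter_restrict[OF fin, symmetric])
    finally show "(\<Sum>i\<in>G \<inter> src A j. card (G \<inter> src A j - {i}))
        = (\<Sum>i\<in>G. \<Sum>h\<in>G - {i}. if j \<in> tgt A i \<inter> tgt A h then 1 else 0)" by simp
  qed
  also have "\<dots> = (\<Sum>i\<in>G. \<Sum>j<v. \<Sum>h\<in>G - {i}. if j \<in> tgt A i \<inter> tgt A h then 1 else 0)"
    by (rule sum.swap)
  also have "\<dots> = (\<Sum>i\<in>G. \<Sum>h\<in>G - {i}. \<Sum>j<v. if j \<in> tgt A i \<inter> tgt A h then 1 else 0)"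
    by (rule sum.cong[OF refl], rule sum.swap)
  also have "\<dots> = (\<Sum>i\<in>G. \<Sum>h\<in>G - {i}. lam)"
  proof (intro sum.cong refl)
    fix i h assume ih: "i \<in> G" "h \<in> G - {i}"
    have "{..<v} \<inter> (tgt A i \<inter> tgt A h) = tgt A i \<inter> tgt A h"
      using tgt_subset by blast
    then have "(\<Sum>j<v. if j \<in> tgt A i \<inter> tgt A h then 1 else (0::nat)) = card (tgt A i \<inter> tgt A h)"
      by (simp add: sum.If_cases del: Int_iff)
    then show "(\<Sum>j<v. if j \<in> tgt A i \<inter> tgt A h then 1 else 0) = lam"
      using card_common_tgt[of i h] ih G by auto
  qed
  also have "\<dots> = lam * (card G * (card G - 1))"
    using fin by (simp add: card_Diff_singleton_if)
  finally show ?thesis .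
qed

section \<open>Upper bound\<close>

text \<open>The inequality for one level set \<open>G\<close>. The summand
  \<open>if ... then 0 else 1\<close> encodes that it is strict unless \<open>G = F\<close> and
  \<open>card F = p\<close>.\<close>

lemma level_bound:
  fixes F G :: "nat set" and p :: nat
  assumes F: "F \<subseteq> {..<v}" and GF: "G \<subseteq> F" and cF: "card F \<le> p" and p: "3 \<le> p"
    and G: "G \<noteq> {}"
  shows "(\<Sum>j\<in>{..<v} - F. card (G \<inter> src A j) * (card (G \<inter> src A j) - 1)) +
      (\<Sum>j\<in>F. card (G \<inter> src A j)) + (if G = F \<and> card F = p then 0 else 1)
      \<le> (lam * (p - 1) + 1) * card G"
    (is "?S + ?R + ?e \<le> _")
proof -
  have fF: "finite F" using F finite_subset by blast
  then have fG: "finite G" using GF finite_subset by blast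
  have g1: "1 \<le> card G" using fG G by (simp add: Suc_le_eq card_gt_0_iff)
  have gf: "card G \<le> card F" using fF GF card_mono by blast
  show ?thesis
  proof (cases "card G = 1")
    case True
    then obtain i where i: "G = {i}" using card_1_singletonE by blast
    have "?S = 0" by (auto simp: i Int_insert_left)
    \<comment> \<open>Each failed column contributes at most 1, and column \<open>i\<close> itself
      contributes 0 because the diagonal of \<open>A\<close> is zero.\<close>
    moreover have "?R < card F"
    proof -
      have "i \<in> F" "i < v" using i GF F by auto
      have "i \<notin> src A i" using diag[OF \<open>i < v\<close>] by (auto simp: src_def)
      have "?R = card (G \<inter> src A i) + (\<Sum>j\<in>F - {i}. card (G \<inter> src A j))"
        using \<open>i \<in> F\<close> fF by (simp add: sum.remove)
      also have "\<dots> \<le> 0 + (\<Sum>j\<in>F - {i}. 1)"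
        using \<open>i \<notin> src A i\<close>
        by (intro add_mono sum_mono) (auto simp: i Int_insert_left)
      also have "\<dots> < card F" using \<open>i \<in> F\<close> fF
        by (simp add: card_Diff1_less del: card_Diff_insert)
      finally show ?thesis .
    qed
    moreover have "card F \<le> lam * (p - 1) + 1"
    proof -
      have "1 * (p - 1) \<le> lam * (p - 1)" using params by (intro mult_right_mono) auto
      then show ?thesis using cF by linarith
    qed
    moreover have "?e \<le> 1" by simp
    ultimately show ?thesis unfolding True mult_1_right by linarith
  next
    case False
    then have g2: "2 \<le> card G" using g1 by simp
    have "?R \<le> (\<Sum>j\<in>F. card (G \<inter> src A j) * (card (G \<inter> src A j) - 1) + 1)"
    proof (rule sum_mono)
      fix j show "card (G \<inter> src A j) \<le> card (G \<inter> src A j) * (card (G \<inter> src A j) - 1) + 1"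
        by (cases "card (G \<inter> src A j)") auto
    qed
    also have "\<dots> = (\<Sum>j\<in>F. card (G \<inter> src A j) * (card (G \<inter> src A j) - 1)) + card F"
      by (simp only: sum.distrib) simp
    \<comment> \<open>The pair counts of the failed columns complete \<open>?S\<close> to a sum over
      all columns, which \<open>sum_d_pairs\<close> evaluates.\<close>
    finally have "?S + ?R + ?e \<le> (\<Sum>j<v. card (G \<inter> src A j) * (card (G \<inter> src A j) - 1)) + card F + ?e"
      using sum.subset_diff[OF F, of "\<lambda>j. card (G \<inter> src A j) * (card (G \<inter> src A j) - 1)"] by simp
    also have "\<dots> = lam * (card G * (card G - 1)) + card F + ?e"
      using sum_d_pairs[of G] GF F by simp
    also have "\<dots> \<le> (lam * (p - 1) + 1) * card G"
    proof -
      define g where "g = card G"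
      \<comment> \<open>The slack \<open>e = p - card G\<close> enters the right side with factor
        \<open>lam * g\<close>, which is at least 2. One copy of \<open>e\<close> covers
        \<open>card F - card G\<close>, the other covers \<open>?e\<close>; if \<open>e = 0\<close>
        then \<open>G = F\<close> and \<open>card F = p\<close>, so \<open>?e = 0\<close>.\<close>
      obtain e where e: "p = g + e" using gf cF le_Suc_ex g_def by (metis le_trans)
      have pos: "?e = 0 \<or> e > 0 \<or> card F < p"
        using card_subset_eq[OF fF GF] gf cF e g_def by fastforce
      have "p - 1 = g - 1 + e" using e g1 g_def by simp
      then have eq: "(lam * (p - 1) + 1) * g = lam * (g * (g - 1)) + (lam * g) * e + g"
        by (simp add: algebra_simps)
      have "2 \<le> lam * g" using g2 params g_def mult_le_mono[of 1 lam 2 g] by simp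
      then have "2 * e \<le> (lam * g) * e" by (rule mult_right_mono) simp
      moreover have "?e \<le> 1" by simp
      ultimately show ?thesis using eq pos e cF unfolding g_def by linarith
    qed
    finally show ?thesis .
  qed
qed

text \<open>The counting core, freed from placements. Here \<open>n i\<close> stands for the number
  of differing objects at node \<open>i\<close> and \<open>r i j\<close> for those among them with a
  replica at \<open>j\<close>. \<open>r_alive\<close> says that each such replica at an alive node
  has a partner from another failed node, and \<open>r_sum\<close> counts replicas per
  object.\<close>

lemma no_unrecoverable_counts:
  fixes F :: "nat set" and p :: nat and n :: "nat \<Rightarrow> nat" and r :: "nat \<Rightarrow> nat \<Rightarrow> nat"
  assumes F: "F \<subseteq> {..<v}" and cF: "card F \<le> p" and p: "3 \<le> p"
    and unsep: "\<not> (\<exists>F. pairwise_separated A F \<and> card F = p)"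
    and r_le: "\<And>i j. i \<in> F \<Longrightarrow> r i j \<le> n i"
    and r_alive: "\<And>i j. i \<in> F \<Longrightarrow> j < v \<Longrightarrow> j \<notin> F \<Longrightarrow> i \<in> src A j \<Longrightarrow>
      r i j \<le> (\<Sum>h\<in>F \<inter> src A j - {i}. n h)"
    and r_sum: "\<And>i. i \<in> F \<Longrightarrow> (lam * (p - 1) + 1) * n i \<le> (\<Sum>j\<in>tgt A i. r i j)"
    and "i \<in> F"
  shows "n i = 0"
proof (rule ccontr)
  assume "n i \<noteq> 0"
  define q where "q = lam * (p - 1) + 1"
  define M where "M = Max (n ` F)"
  have fF: "finite F" using F finite_subset by blast
  have M: "n i \<le> M" if "i \<in> F" for i using that fF by (simp add: M_def)
  have "M > 0" using M[OF \<open>i \<in> F\<close>] \<open>n i \<noteq> 0\<close> by simp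
  define G where "G s = {i \<in> F. s < n i}" for s
  have level: "{i \<in> F \<inter> src A j. s < n i} = G s \<inter> src A j" for s j by (auto simp: G_def)
  let ?T = "\<lambda>s. (\<Sum>j\<in>{..<v} - F. card (G s \<inter> src A j) * (card (G s \<inter> src A j) - 1)) +
      (\<Sum>j\<in>F. card (G s \<inter> src A j))"
  \<comment> \<open>The maximum is attained, so every level below \<open>M\<close> is nonempty and
    \<open>level_bound\<close> applies to it.\<close>
  have "M \<in> n ` F" unfolding M_def using fF \<open>i \<in> F\<close> by (intro Max_in) auto
  then obtain m where m: "m \<in> F" "n m = M" by auto
  have G_ne: "G s \<noteq> {}" if "s < M" for s using m that by (auto simp: G_def)
  have "q * (\<Sum>i\<in>F. n i) \<le> (\<Sum>i\<in>F. \<Sum>j\<in>tgt A i. r i j)"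
    unfolding sum_distrib_left q_def by (intro sum_mono r_sum)
  also have "\<dots> = (\<Sum>i\<in>F. \<Sum>j<v. if i \<in> src A j then r i j else 0)"
  proof (rule sum.cong[OF refl])
    fix i assume "i \<in> F"
    then have "tgt A i = {..<v} \<inter> {j. i \<in> src A j}"
      using mem_tgt_iff_mem_src[of i] tgt_subset[of i] F by auto
    then show "(\<Sum>j\<in>tgt A i. r i j) = (\<Sum>j<v. if i \<in> src A j then r i j else 0)"
      by (simp add: sum.If_cases)
  qed
  also have "\<dots> = (\<Sum>j<v. \<Sum>i\<in>F. if i \<in> src A j then r i j else 0)"
    by (rule sum.swap)
  also have "\<dots> = (\<Sum>j<v. \<Sum>i\<in>F \<inter> src A j. r i j)"
    using fF by (simp add: sum.inter_restrict)
  also have "\<dots> = (\<Sum>j\<in>{..<v} - F. \<Sum>i\<in>F \<inter> src A j. r i j) + (\<Sum>j\<in>F. \<Sum>i\<in>F \<inter> src A j. r i j)"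
    using sum.subset_diff[OF F] by simp
  finally have total: "q * (\<Sum>i\<in>F. n i) \<le>
    (\<Sum>j\<in>{..<v} - F. \<Sum>i\<in>F \<inter> src A j. r i j) + (\<Sum>j\<in>F. \<Sum>i\<in>F \<inter> src A j. r i j)" .
  have "(\<Sum>s<M. q * card (G s)) = q * (\<Sum>i\<in>F. n i)"
    using sum_level_sets[OF fF M] by (simp add: G_def sum_distrib_left)
  also have "\<dots> \<le> (\<Sum>j\<in>{..<v} - F. \<Sum>i\<in>F \<inter> src A j. r i j) + (\<Sum>j\<in>F. \<Sum>i\<in>F \<inter> src A j. r i j)"
    by (fact total)
  \<comment> \<open>At alive columns \<open>le_sum_min\<close> merges \<open>r_le\<close> and
    \<open>r_alive\<close>; at failed columns only \<open>r_le\<close> is available.\<close>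
  also have "\<dots> \<le> (\<Sum>j\<in>{..<v} - F. \<Sum>i\<in>F \<inter> src A j. \<Sum>h\<in>F \<inter> src A j - {i}. min (n i) (n h)) +
      (\<Sum>j\<in>F. \<Sum>i\<in>F \<inter> src A j. n i)"
    using fF by (intro add_mono sum_mono le_sum_min r_le r_alive) auto
  also have "\<dots> = (\<Sum>j\<in>{..<v} - F. \<Sum>s<M. card (G s \<inter> src A j) * (card (G s \<inter> src A j) - 1)) +
      (\<Sum>j\<in>F. \<Sum>s<M. card (G s \<inter> src A j))"
    using fF M
    by (intro arg_cong2[where f = "(+)"] sum.cong refl
      sum_min_level_sets[of "F \<inter> src A _" n M, unfolded level]
      sum_level_sets[of "F \<inter> src A _" n M, unfolded level]) auto
  also have "\<dots> = (\<Sum>s<M. ?T s)"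
    unfolding sum.distrib by (intro arg_cong2[where f = "(+)"] sum.swap)
  finally have levels: "(\<Sum>s<M. q * card (G s)) \<le> (\<Sum>s<M. ?T s)" .
  \<comment> \<open>A single level with strict inequality would make the sum over all levels
    contradict \<open>levels\<close>.\<close>
  have full: "G s = F \<and> card F = p" if s: "s < M" for s
  proof (rule ccontr)
    assume not_full: "\<not> (G s = F \<and> card F = p)"
    have bound: "?T s + (if G s = F \<and> card F = p then 0 else 1) \<le> q * card (G s)" if "s < M" for s
      unfolding q_def using F cF p G_ne[OF that] by (intro level_bound) (auto simp: G_def)
    have "(\<Sum>s<M. ?T s) < (\<Sum>s<M. q * card (G s))"
    proof (rule sum_strict_mono_ex1)
      show "\<forall>s\<in>{..<M}. ?T s \<le> q * card (G s)"
        using bound by (meson add_leD1 lessThan_iff)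
      show "\<exists>s\<in>{..<M}. ?T s < q * card (G s)"
        using bound[OF s] not_full s by (intro bexI[of _ s]) (simp_all add: less_eq_Suc_le)
    qed simp
    then show False using levels by simp
  qed
  have cFp: "card F = p" using full[OF \<open>M > 0\<close>] by simp
  \<comment> \<open>The top level \<open>M - 1\<close> is already all of \<open>F\<close>, which
    forces every \<open>n i\<close> up to the maximum.\<close>
  have n_eq: "n i = M" if "i \<in> F" for i
  proof -
    have "i \<in> G (M - 1)" using full[of "M - 1"] \<open>M > 0\<close> that by simp
    then have "M - 1 < n i" by (simp add: G_def)
    then show ?thesis using M[OF that] \<open>M > 0\<close> by linarith
  qed
  define D where "D j = card (F \<inter> src A j)" for j
  obtain t where t: "t < v" "3 \<le> D t"
  proof -
    have "\<not> pairwise_separated A F" using unsep cFp by blast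
    then obtain t where "t < v" "\<not> d A F t \<le> 2"
      using F by (auto simp: pairwise_separated_def dim)
    then show thesis using that[of t] d_eq_card[OF F] by (simp add: D_def)
  qed
  define S where "S j = (\<Sum>i\<in>F \<inter> src A j. r i j)" for j
  have S_le: "S j \<le> M * D j" for j
  proof -
    have "S j \<le> (\<Sum>i\<in>F \<inter> src A j. M)"
      unfolding S_def by (rule sum_mono) (use r_le n_eq in fastforce)
    then show ?thesis by (simp add: D_def mult.commute)
  qed
  have D_le: "D j \<le> D j * (D j - 1)" if "2 \<le> D j" for j
    using that by simp
  \<comment> \<open>A bound per column whose total is exactly \<open>q * (M * p)\<close>, so one
    strict column suffices. An alive column with \<open>D j = 1\<close> has \<open>S j = 0\<close>,
    since its only failed source has no partner there.\<close>
  let ?b = "\<lambda>j. M * (D j * (D j - 1) + (if j \<in> F then 1 else 0))"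
  have S_bound: "S j \<le> ?b j" if j: "j < v" for j
  proof (cases "j \<in> F \<or> 2 \<le> D j")
    case True
    have "D j \<le> D j * (D j - 1) + (if j \<in> F then 1 else 0)"
    proof (cases "2 \<le> D j")
      case True
      then show ?thesis using D_le[OF True] by linarith
    next
      case False
      then show ?thesis using \<open>j \<in> F \<or> 2 \<le> D j\<close> by auto
    qed
    then show ?thesis using S_le[of j] by (meson le_trans mult_le_mono2)
  next
    case False
    have "S j = 0"
    proof (cases "D j = 0")
      case True
      then show ?thesis using S_le[of j] by simp
    next
      case nz: False
      then have "card (F \<inter> src A j) = 1" using False by (simp add: D_def)
      then obtain i where i: "F \<inter> src A j = {i}" using card_1_singletonE by blast
      then have "i \<in> F" "i \<in> src A j" by auto
      then show ?thesis using r_alive[of i j] False j by (simp add: S_def i)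
    qed
    then show ?thesis by simp
  qed
  \<comment> \<open>With at least three failed sources, \<open>D t - 1\<close> is at least 2, so
    \<open>D t\<close> is smaller than \<open>D t * (D t - 1)\<close>.\<close>
  have S_strict: "S t < ?b t"
  proof -
    have "D t * 1 < D t * (D t - 1)" using t by (intro mult_strict_left_mono) auto
    then have "D t < D t * (D t - 1) + (if t \<in> F then 1 else 0)" by linarith
    then have "M * D t < ?b t" using \<open>M > 0\<close> by (intro mult_strict_left_mono) auto
    then show ?thesis using S_le[of t] by linarith
  qed
  have "q * (M * p) = q * (\<Sum>i\<in>F. n i)" using n_eq cFp by simp
  also have "\<dots> \<le> (\<Sum>j<v. S j)"
    using total sum.subset_diff[OF F, of S] by (simp add: S_def)
  also have "\<dots> < (\<Sum>j<v. ?b j)"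
    using S_bound S_strict t by (intro sum_strict_mono_ex1 bexI[of _ t] ballI) simp_all
  also have "\<dots> = M * (lam * (p * (p - 1)) + p)"
  proof -
    have "(\<Sum>j<v. if j \<in> F then 1 else (0::nat)) = p"
      using F cFp by (simp add: sum.If_cases Int_absorb1)
    then show ?thesis
      using sum_d_pairs[OF F] by (simp add: D_def cFp sum_distrib_left[symmetric] sum.distrib)
  qed
  also have "\<dots> = q * (M * p)" by (simp add: q_def algebra_simps)
  finally show False by simp
qed

text \<open>Two assignments that agree on everything alive yield numbers \<open>n\<close> and
  \<open>r\<close> satisfying the hypotheses of \<open>no_unrecoverable_counts\<close>.\<close>

lemma universal_count_upper:
  fixes p :: nat
  assumes p: "3 \<le> p" and unsep: "\<not> (\<exists>F. pairwise_separated A F \<and> card F = p)"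
  shows "universal_count A k p (lam * (p - 1) + 1)"
  unfolding universal_count_def permits_recovery_def
proof (intro allI impI ballI; elim conjE)
  fix L :: nat and P F w w' x0
  assume legal: "legal_placement A k (lam * (p - 1) + 1) P"
    and "F \<subseteq> {..<dim_row A}" and cF: "card F \<le> p"
    and carrier: "\<forall>x\<in>objects P. w x \<in> carrier_vec L \<and> w' x \<in> carrier_vec L"
    and alive: "\<forall>x\<in>objects P. primary P x \<notin> F \<longrightarrow> w x = w' x"
    and parities: "\<forall>j<dim_row A. j \<notin> F \<longrightarrow> (\<forall>t\<in>tuples P j. parity L w t = parity L w' t)"
    and x0: "x0 \<in> objects P" "primary P x0 \<in> F"
  have F: "F \<subseteq> {..<v}" using \<open>F \<subseteq> {..<dim_row A}\<close> dim by simp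
  have fF: "finite F" using F finite_subset by blast
  have fin: "finite (objects P)" using legal by (simp add: legal_placement_def)
  define U where "U = {x \<in> objects P. w x \<noteq> w' x}"
  have fU: "finite U" using fin by (simp add: U_def)
  define n where "n i = card {x \<in> U. primary P x = i}" for i
  define r where "r i j = card {x \<in> U. primary P x = i \<and> j \<in> targets P x}" for i j
  have tg: "targets P x \<subseteq> tgt A (primary P x)" "card (targets P x) = lam * (p - 1) + 1"
    "primary P x < v" if "x \<in> U" for x
    using that legal by (auto simp: legal_placement_def U_def dim)
  have U_F: "primary P x \<in> F" if "x \<in> U" for x
    using that alive by (auto simp: U_def)
  \<comment> \<open>If \<open>x\<close> were the only differing object of the tuple, the other
    summands would cancel from the equal parities and leave \<open>w x = w' x\<close>.\<close>
  have partner: "\<exists>y\<in>U. y \<in> t \<and> y \<noteq> x"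
    if "j < v" "j \<notin> F" "t \<in> tuples P j" "x \<in> t" "x \<in> U" for j t x
  proof (rule ccontr)
    assume no: "\<not> (\<exists>y\<in>U. y \<in> t \<and> y \<noteq> x)"
    have part: "partition_on (received P j) (tuples P j)" "card t = k"
      using legal that by (auto simp: legal_placement_def dim)
    then have tsub: "t \<subseteq> objects P" using that(3)
      by (auto simp: received_def dest: partition_onD1)
    have ft: "finite t" using tsub fin finite_subset by blast
    have same: "w y = w' y" if "y \<in> t - {x}" for y
      using no that tsub by (auto simp: U_def)
    have "w x = w' x"
    proof (rule eq_vecI)
      have cx: "w x \<in> carrier_vec L" "w' x \<in> carrier_vec L"
        using carrier \<open>x \<in> U\<close> by (auto simp: U_def)
      then show "dim_vec (w x) = dim_vec (w' x)" by simp
      fix l assume "l < dim_vec (w' x)"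
      then have l: "l < L" using cx by simp
      have "parity L w t = parity L w' t" using parities that by (simp add: dim)
      then have "parity L w t $ l = parity L w' t $ l" by simp
      then have "(\<Sum>y\<in>t. w y $ l) = (\<Sum>y\<in>t. w' y $ l)" using l by (simp add: parity_def)
      moreover have "(\<Sum>y\<in>t - {x}. w y $ l) = (\<Sum>y\<in>t - {x}. w' y $ l)" using same by simp
      ultimately show "w x $ l = w' x $ l"
        using ft \<open>x \<in> t\<close> by (simp only: sum.remove[of t x]) (metis add_right_cancel)
    qed
    then show False using \<open>x \<in> U\<close> by (simp add: U_def)
  qed
  have "n (primary P x0) = 0"
  proof (rule no_unrecoverable_counts[where n = n and r = r, OF F cF p unsep])
    show "primary P x0 \<in> F" by fact
    show "r i j \<le> n i" for i j
      unfolding r_def n_def using fU by (intro card_mono) auto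
    show "(lam * (p - 1) + 1) * n i \<le> (\<Sum>j\<in>tgt A i. r i j)" if "i \<in> F" for i
    proof -
      let ?U = "{x \<in> U. primary P x = i}"
      \<comment> \<open>Pairs of a differing object at \<open>i\<close> and one of its targets,
        counted first by target and then by object.\<close>
      have "(\<Sum>j\<in>tgt A i. r i j) = (\<Sum>j\<in>tgt A i. \<Sum>x\<in>?U. if j \<in> targets P x then 1 else 0)"
        using fU by (auto simp: r_def sum.If_cases Int_def conj_assoc intro!: sum.cong arg_cong[where f = card])
      also have "\<dots> = (\<Sum>x\<in>?U. \<Sum>j\<in>tgt A i. if j \<in> targets P x then 1 else 0)"
        by (rule sum.swap)
      also have "\<dots> = (\<Sum>x\<in>?U. lam * (p - 1) + 1)"
      proof (rule sum.cong[OF refl])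
        fix x assume x: "x \<in> ?U"
        then have "tgt A i \<inter> targets P x = targets P x" using tg(1)[of x] by auto
        then show "(\<Sum>j\<in>tgt A i. if j \<in> targets P x then 1 else 0) = lam * (p - 1) + 1"
          using x tg(2)[of x] finite_tgt by (simp add: sum.If_cases)
      qed
      finally show ?thesis by (simp add: n_def)
    qed
    show "r i j \<le> (\<Sum>h\<in>F \<inter> src A j - {i}. n h)"
      if i: "i \<in> F" "j < v" "j \<notin> F" "i \<in> src A j" for i j
    proof -
      let ?X = "{x \<in> U. primary P x = i \<and> j \<in> targets P x}"
      have part: "partition_on (received P j) (tuples P j)"
        and one: "\<And>t h. t \<in> tuples P j \<Longrightarrow> h \<in> src A j \<Longrightarrow> \<exists>!x. x \<in> t \<and> primary P x = h"
        using legal i by (auto simp: legal_placement_def dim)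
      have "\<forall>x\<in>?X. \<exists>y. y \<in> U \<and> y \<noteq> x \<and> (\<exists>t\<in>tuples P j. x \<in> t \<and> y \<in> t)"
      proof
        fix x assume x: "x \<in> ?X"
        then have "x \<in> received P j" by (auto simp: received_def U_def)
        then obtain t where t: "t \<in> tuples P j" "x \<in> t"
          using part by (auto dest: partition_onD1)
        then show "\<exists>y. y \<in> U \<and> y \<noteq> x \<and> (\<exists>t\<in>tuples P j. x \<in> t \<and> y \<in> t)"
          using partner[of j t x] i x by auto
      qed
      then obtain f where f: "\<And>x. x \<in> ?X \<Longrightarrow> f x \<in> U \<and> f x \<noteq> x \<and>
          (\<exists>t\<in>tuples P j. x \<in> t \<and> f x \<in> t)"
        by metis
      \<comment> \<open>A shared partner puts \<open>x\<close> and \<open>y\<close> in the same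
        tuple, because tuples at \<open>j\<close> are disjoint; that tuple has only one object from
        node \<open>i\<close>.\<close>
      have inj: "inj_on f ?X"
      proof (rule inj_onI)
        fix x y assume xy: "x \<in> ?X" "y \<in> ?X" "f x = f y"
        obtain t u where t: "t \<in> tuples P j" "x \<in> t" "f x \<in> t"
          and u: "u \<in> tuples P j" "y \<in> u" "f y \<in> u"
          using f xy by metis
        have "t = u"
          using disjointD[OF partition_onD2[OF part] t(1) u(1)] t u xy by auto
        then show "x = y" using one[OF t(1) i(4)] t u xy by auto
      qed
      have "f ` ?X \<subseteq> (\<Union>h\<in>F \<inter> src A j - {i}. {x \<in> U. primary P x = h})"
      proof (rule image_subsetI)
        fix x assume x: "x \<in> ?X"
        obtain t where t: "t \<in> tuples P j" "x \<in> t" "f x \<in> t" using f[OF x] by blast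
        have fx: "f x \<in> U" "f x \<noteq> x" using f[OF x] by auto
        have "f x \<in> received P j" using t part by (auto dest: partition_onD1)
        then have "j \<in> tgt A (primary P (f x))"
          using tg(1)[OF fx(1)] by (auto simp: received_def)
        then have "primary P (f x) \<in> src A j"
          using mem_tgt_iff_mem_src tg(3)[OF fx(1)] i by auto
        moreover have "primary P (f x) \<noteq> i"
          using one[OF t(1) i(4)] t x fx by auto
        ultimately show "f x \<in> (\<Union>h\<in>F \<inter> src A j - {i}. {x \<in> U. primary P x = h})"
          using U_F[OF fx(1)] fx by auto
      qed
      then have "card (f ` ?X) \<le> card (\<Union>h\<in>F \<inter> src A j - {i}. {x \<in> U. primary P x = h})"
        using fU fF by (intro card_mono) auto
      also have "\<dots> \<le> (\<Sum>h\<in>F \<inter> src A j - {i}. n h)"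
        unfolding n_def using fF by (intro card_UN_le) auto
      finally show ?thesis using card_image[OF inj] by (simp add: r_def)
    qed
  qed
  then show "w x0 = w' x0"
    using fU x0 unfolding n_def by (subst (asm) card_0_eq) (auto simp: U_def intro: rev_finite_subset)
qed

section \<open>Lower bound by cyclic placements\<close>

text \<open>Each node \<open>i\<close> owns \<open>k\<close> objects \<open>i * k + s\<close>, and object \<open>s\<close> takes the \<open>q\<close> cyclically
  consecutive targets from position \<open>s\<close> on in the enumeration \<open>e i\<close> of the admissible targets.  At a
  node \<open>j\<close>, the objects having \<open>j\<close> as their \<open>r\<close>-th target form one tuple.\<close>

definition cyclic_tuple :: "(nat \<Rightarrow> nat \<Rightarrow> nat) \<Rightarrow> nat \<Rightarrow> nat \<Rightarrow> nat set" where
  "cyclic_tuple e j r = {x. x < v * k \<and> e (x div k) ((x mod k + r) mod k) = j}"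

definition cyclic_placement :: "(nat \<Rightarrow> nat \<Rightarrow> nat) \<Rightarrow> nat \<Rightarrow> placement" where
  "cyclic_placement e q =
    \<lparr>objects = {..<v * k}, primary = (\<lambda>x. x div k),
     targets = (\<lambda>x. (\<lambda>r. e (x div k) ((x mod k + r) mod k)) ` {..<q}),
     tuples = (\<lambda>j. cyclic_tuple e j ` {..<q})\<rparr>"

lemma cyclic_placement_simps [simp]:
  "objects (cyclic_placement e q) = {..<v * k}"
  "primary (cyclic_placement e q) x = x div k"
  "targets (cyclic_placement e q) x = (\<lambda>r. e (x div k) ((x mod k + r) mod k)) ` {..<q}"
  "tuples (cyclic_placement e q) j = cyclic_tuple e j ` {..<q}"
  by (simp_all add: cyclic_placement_def)

text \<open>If \<open>j\<close> has position \<open>m\<close> in the enumeration of source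
  \<open>h\<close>, then the only object of \<open>h\<close> in the tuple for \<open>r\<close> is
  the one whose start \<open>s\<close> satisfies \<open>s + r = m\<close> modulo \<open>k\<close>.
  So taking primaries maps each tuple bijectively onto \<open>src A j\<close>.\<close>

lemma legal_cyclic_placement:
  assumes e: "\<And>i. i < v \<Longrightarrow> bij_betw (e i) {..<k} (tgt A i)" and q: "q \<le> k"
  shows "legal_placement A k q (cyclic_placement e q)"
proof -
  let ?\<tau> = "\<lambda>x r. e (x div k) ((x mod k + r) mod k)"
  have k: "0 < k" using params by simp
  have e_inj: "a = b" if "i < v" "a < k" "b < k" "e i a = e i b" for i a b
    using inj_onD[OF bij_betw_imp_inj_on[OF e[OF that(1)]] that(4)] that by simp
  have \<tau>_tgt: "?\<tau> x r \<in> tgt A (x div k)" if "x < v * k" for x r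
    using e[OF less_mult_imp_div_less[OF that]] k by (auto simp: bij_betw_def)
  have \<tau>_inj: "r = r'" if "x < v * k" "r < k" "r' < k" "?\<tau> x r = ?\<tau> x r'" for x r r'
  proof (rule mod_add_cancel_less)
    show "(x mod k + r) mod k = (x mod k + r') mod k"
      using e_inj[OF less_mult_imp_div_less[OF that(1)] _ _ that(4)] k by simp
  qed (fact that)+
  have unique: "\<exists>!x. x \<in> cyclic_tuple e j r \<and> x div k = h"
    if j: "j < v" and r: "r < q" and h: "h \<in> src A j" for j r h
  proof -
    have hv: "h < v" using h by (simp add: src_def dim)
    then have "j \<in> tgt A h" using h j mem_tgt_iff_mem_src by simp
    then have "j \<in> e h ` {..<k}" using e[OF hv] by (simp add: bij_betw_def)
    then obtain m where m: "m < k" "e h m = j" by auto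
    \<comment> \<open>This is \<open>m - r\<close> modulo \<open>k\<close>; adding
      \<open>k - r\<close> avoids truncated subtraction.\<close>
    define s where "s = (m + (k - r)) mod k"
    have s: "s < k" "(s + r) mod k = m"
      using k m r q by (auto simp: s_def mod_add_left_eq)
    show ?thesis
    proof (rule ex1I[of _ "h * k + s"])
      have "h * k + s < v * k"
        using hv s(1) mult_le_mono1[of "Suc h" v k] by simp
      then show "h * k + s \<in> cyclic_tuple e j r \<and> (h * k + s) div k = h"
        using s m by (simp add: cyclic_tuple_def)
      fix x assume x: "x \<in> cyclic_tuple e j r \<and> x div k = h"
      then have "e h ((x mod k + r) mod k) = e h m" using m by (auto simp: cyclic_tuple_def)
      then have "(x mod k + r) mod k = m"
        using e_inj[OF hv, of "(x mod k + r) mod k" m] k m by simp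
      then have "x mod k = s"
        using mod_add_cancel_less[of r "x mod k" k s] s k by (simp add: add.commute)
      then show "x = h * k + s" using x by (metis div_mult_mod_eq)
    qed
  qed
  have primary_src: "x div k \<in> src A j" if "x \<in> cyclic_tuple e j r" "j < v" for x j r
  proof -
    have x: "x < v * k" "?\<tau> x r = j" using that(1) unfolding cyclic_tuple_def by blast+
    show ?thesis
      using \<tau>_tgt[OF x(1), of r] mem_tgt_iff_mem_src[OF less_mult_imp_div_less[OF x(1)] that(2)]
      unfolding x(2) by blast
  qed
  have card_tuple: "card (cyclic_tuple e j r) = k" if "j < v" "r < q" for j r
  proof -
    have "bij_betw (\<lambda>x. x div k) (cyclic_tuple e j r) (src A j)"
    proof (rule bij_betw_imageI)
      show "inj_on (\<lambda>x. x div k) (cyclic_tuple e j r)"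
      proof (rule inj_onI)
        fix x y assume xy: "x \<in> cyclic_tuple e j r" "y \<in> cyclic_tuple e j r" "x div k = y div k"
        show "x = y" using unique[OF that primary_src[OF xy(1) that(1)]] xy by auto
      qed
      show "(\<lambda>x. x div k) ` cyclic_tuple e j r = src A j"
      proof (intro equalityI subsetI)
        fix h assume "h \<in> src A j"
        from unique[OF that this] show "h \<in> (\<lambda>x. x div k) ` cyclic_tuple e j r" by blast
      qed (use primary_src that in blast)
    qed
    then show ?thesis using card_src[OF that(1)] bij_betw_same_card by fastforce
  qed
  have card_targets: "card (?\<tau> x ` {..<q}) = q" if "x < v * k" for x
  proof -
    have "inj_on (?\<tau> x) {..<q}"
    proof (rule inj_onI)
      fix r r' assume "r \<in> {..<q}" "r' \<in> {..<q}" "?\<tau> x r = ?\<tau> x r'"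
      then show "r = r'" using \<tau>_inj[OF that, of r r'] q by simp
    qed
    then show ?thesis by (simp add: card_image)
  qed
  have part: "partition_on (received (cyclic_placement e q) j) (cyclic_tuple e j ` {..<q})"
    if j: "j < v" for j
  proof (rule partition_onI)
    show "\<Union> (cyclic_tuple e j ` {..<q}) = received (cyclic_placement e q) j"
      by (auto simp: received_def cyclic_tuple_def)
    show "{} \<notin> cyclic_tuple e j ` {..<q}" using card_tuple[OF j] k by fastforce
  next
    fix t u assume tu: "t \<in> cyclic_tuple e j ` {..<q}" "u \<in> cyclic_tuple e j ` {..<q}" "t \<noteq> u"
    then obtain r r' where r: "r < q" "r' < q" "t = cyclic_tuple e j r" "u = cyclic_tuple e j r'"
      by blast
    show "disjnt t u"
      unfolding disjnt_iff
    proof (intro allI notI, elim conjE)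
      fix x assume "x \<in> t" "x \<in> u"
      then have "x < v * k" "?\<tau> x r = ?\<tau> x r'" by (auto simp: r cyclic_tuple_def)
      then have "r = r'" using \<tau>_inj[of x r r'] r q by simp
      then show False using r tu by simp
    qed
  qed
  show ?thesis
    unfolding legal_placement_def dim cyclic_placement_simps
  proof (intro conjI ballI allI impI)
    show "finite {..<v * k}" by simp
    show "x div k < v" if "x \<in> {..<v * k}" for x
      using that less_mult_imp_div_less by simp
    show "?\<tau> x ` {..<q} \<subseteq> tgt A (x div k)" if "x \<in> {..<v * k}" for x
      using that \<tau>_tgt by blast
    show "card (?\<tau> x ` {..<q}) = q" if "x \<in> {..<v * k}" for x
      using that card_targets by simp
    show "partition_on (received (cyclic_placement e q) j) (cyclic_tuple e j ` {..<q})"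
      if "j < v" for j
      using part[OF that] .
    show "card t = k" if "j < v" "t \<in> cyclic_tuple e j ` {..<q}" for j t
      using that card_tuple by blast
    show "\<exists>!x. x \<in> t \<and> x div k = h"
      if "j < v" "t \<in> cyclic_tuple e j ` {..<q}" "h \<in> src A j" for j t h
    proof -
      obtain r where "r < q" "t = cyclic_tuple e j r" using \<open>t \<in> _\<close> by blast
      then show ?thesis using unique[OF \<open>j < v\<close> _ \<open>h \<in> _\<close>] by simp
    qed
  qed
qed

text \<open>With words of length 1, compare the indicator of \<open>X\<close> with the zero
  assignment: a tuple's parities differ by the number of its members in \<open>X\<close> modulo 2,
  so no alive node notices the change.\<close>

lemma not_universal_if_unseen_difference:
  assumes e: "\<And>i. i < v \<Longrightarrow> bij_betw (e i) {..<k} (tgt A i)" and q: "q \<le> k"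
    and F: "F \<subseteq> {..<v}" "card F \<le> p"
    and X: "X \<subseteq> {..<v * k}" "X \<noteq> {}" "(\<lambda>x. x div k) ` X \<subseteq> F"
    and even_X: "\<And>j r. j < v \<Longrightarrow> j \<notin> F \<Longrightarrow> r < q \<Longrightarrow> even (card (cyclic_tuple e j r \<inter> X))"
  shows "\<not> universal_count A k p q"
proof
  assume "universal_count A k p q"
  then have rec: "permits_recovery A 1 (cyclic_placement e q) F"
    using legal_cyclic_placement[OF e q] F by (simp add: universal_count_def dim)
  define w where "w x = vec 1 (\<lambda>_. if x \<in> X then 1 else 0 :: bit)" for x :: nat
  define w' where "w' x = vec 1 (\<lambda>_. 0 :: bit)" for x :: nat
  have par: "parity 1 w (cyclic_tuple e j r) = parity 1 w' (cyclic_tuple e j r)"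
    if "j < v" "j \<notin> F" "r < q" for j r
  proof -
    have fin: "finite (cyclic_tuple e j r)"
      by (rule finite_subset[of _ "{..<v * k}"]) (auto simp: cyclic_tuple_def)
    have "(\<Sum>x\<in>cyclic_tuple e j r. if x \<in> X then 1 else 0) = (of_nat (card (cyclic_tuple e j r \<inter> X)) :: bit)"
      using fin by (simp add: sum.If_cases)
    also have "\<dots> = 0" using even_X[OF that] by (auto elim!: evenE)
    finally show ?thesis by (auto simp: parity_def w_def w'_def)
  qed
  obtain x where x: "x \<in> X" using X by blast
  have "w x = w' x"
  proof -
    have "\<forall>x\<in>{..<v * k}. w x \<in> carrier_vec 1 \<and> w' x \<in> carrier_vec 1"
      by (simp add: w_def w'_def)
    moreover have "\<forall>x\<in>{..<v * k}. x div k \<notin> F \<longrightarrow> w x = w' x"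
      using X by (auto simp: w_def w'_def)
    moreover have "\<forall>j<v. j \<notin> F \<longrightarrow> (\<forall>t\<in>cyclic_tuple e j ` {..<q}. parity 1 w t = parity 1 w' t)"
      using par by blast
    moreover have "x \<in> {..<v * k}" "x div k \<in> F" using x X by auto
    ultimately show ?thesis
      using rec unfolding permits_recovery_def dim cyclic_placement_simps by blast
  qed
  then have "w x $ 0 = w' x $ 0" by simp
  then show False using x by (simp add: w_def w'_def)
qed

text \<open>The prescribed initial segment \<open>c\<close> lets two nodes list their common targets
  first and in the same order.\<close>

lemma ex_enumeration:
  assumes "i < v" "C \<subseteq> tgt A i" "bij_betw c {..<card C} C"
  shows "\<exists>e. bij_betw e {..<k} (tgt A i) \<and> (\<forall>m<card C. e m = c m)"
proof -
  have le: "card C \<le> k" using card_mono[OF finite_tgt assms(2)] card_tgt[OF assms(1)] by simp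
  have "card (tgt A i - C) = card {card C..<k}"
    using assms card_tgt finite_subset[OF assms(2) finite_tgt] by (simp add: card_Diff_subset)
  then obtain c' where c': "bij_betw c' {card C..<k} (tgt A i - C)"
    using finite_same_card_bij[of "{card C..<k}" "tgt A i - C"] finite_tgt by auto
  have "bij_betw (\<lambda>m. if m \<in> {..<card C} then c m else c' m) ({..<card C} \<union> {card C..<k}) (C \<union> (tgt A i - C))"
    using assms(3) c' by (intro bij_betw_disjoint_Un) auto
  moreover have "{..<card C} \<union> {card C..<k} = {..<k}" using le by auto
  moreover have "C \<union> (tgt A i - C) = tgt A i" using assms by auto
  ultimately show ?thesis
    by (intro exI[of _ "\<lambda>m. if m \<in> {..<card C} then c m else c' m"]) simp
qed

lemma ex_enumerations: "\<exists>e. \<forall>i<v. bij_betw (e i) {..<k} (tgt A i)"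
proof -
  have "\<exists>e. bij_betw e {..<k} (tgt A i)" if "i < v" for i
    using ex_enumeration[OF that, of "{}"] by auto
  then show ?thesis by metis
qed

lemma not_universal_below_p:
  fixes p :: nat
  assumes "q < p" "q \<le> k"
  shows "\<not> universal_count A k p q"
proof -
  obtain e where e: "\<And>i. i < v \<Longrightarrow> bij_betw (e i) {..<k} (tgt A i)"
    using ex_enumerations by blast
  have v: "0 < v" "0 < k" using params by auto
  have sub: "e 0 ` {..<q} \<subseteq> {..<v}"
  proof -
    have "e 0 ` {..<q} \<subseteq> e 0 ` {..<k}" using assms by (intro image_mono) auto
    also have "\<dots> = tgt A 0" using e[of 0] v by (simp add: bij_betw_def)
    finally show ?thesis using tgt_subset by blast
  qed
  show ?thesis
  \<comment> \<open>Object 0 lives at node 0 and its targets are \<open>e 0 r\<close> for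
    \<open>r < q\<close>. Failing all of these nodes costs at most \<open>q + 1\<close> failures,
    hence at most \<open>p\<close>, and leaves no alive tuple containing it.\<close>
  proof (rule not_universal_if_unseen_difference[where e = e and F = "insert 0 (e 0 ` {..<q})" and X = "{0}"])
    show "card (insert 0 (e 0 ` {..<q})) \<le> p"
      using card_insert_le_m1[of p "e 0 ` {..<q}" 0] card_image_le[of "{..<q}" "e 0"] assms by simp
    show "even (card (cyclic_tuple e j r \<inter> {0}))"
      if "j < v" "j \<notin> insert 0 (e 0 ` {..<q})" "r < q" for j r
    proof -
      have "0 \<notin> cyclic_tuple e j r" using that assms by (auto simp: cyclic_tuple_def)
      then show ?thesis by simp
    qed
  qed (use e v sub assms in auto)
qed

lemma not_universal_upto_lam:
  fixes p :: nat
  assumes "q \<le> lam" "2 \<le> p"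
  shows "\<not> universal_count A k p q"
proof -
  have v: "0 < v" "1 < v" "1 < k" using params by auto
  define C where "C = tgt A 0 \<inter> tgt A 1"
  have cC: "card C = lam" unfolding C_def using card_common_tgt v by simp
  have "finite C" unfolding C_def using finite_tgt by simp
  then obtain c where c: "bij_betw c {..<card C} C"
    using finite_same_card_bij[of "{..<card C}" C] by auto
  obtain e0 where e0: "bij_betw e0 {..<k} (tgt A 0)" "\<forall>m<lam. e0 m = c m"
    using ex_enumeration[OF v(1) _ c] cC C_def by auto
  obtain e1 where e1: "bij_betw e1 {..<k} (tgt A 1)" "\<forall>m<lam. e1 m = c m"
    using ex_enumeration[OF v(2) _ c] cC C_def by auto
  obtain e' where e': "\<And>i. i < v \<Longrightarrow> bij_betw (e' i) {..<k} (tgt A i)"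
    using ex_enumerations by blast
  define e where "e = e'(0 := e0, 1 := e1)"
  show ?thesis
  \<comment> \<open>Objects \<open>0\<close> and \<open>k\<close> are the ones with start 0 at nodes
    0 and 1. Their enumerations agree on the first \<open>lam\<close> positions, so for
    \<open>r < q\<close> every tuple contains both or neither.\<close>
  proof (rule not_universal_if_unseen_difference[where e = e and F = "{0, 1}" and X = "{0, k}"])
    show "bij_betw (e i) {..<k} (tgt A i)" if "i < v" for i
      using e' e0 e1 that by (simp add: e_def)
    show "{0, k} \<subseteq> {..<v * k}" using v by auto
    show "even (card (cyclic_tuple e j r \<inter> {0, k}))" if "r < q" for j r
    proof -
      have "r < k" "r < lam" using that assms params by auto
      then have "0 \<in> cyclic_tuple e j r \<longleftrightarrow> k \<in> cyclic_tuple e j r"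
        using v e0 e1 by (simp add: cyclic_tuple_def e_def)
      then have "cyclic_tuple e j r \<inter> {0, k} = {} \<or> cyclic_tuple e j r \<inter> {0, k} = {0, k}" by blast
      then show ?thesis using v by (elim disjE) simp_all
    qed
  qed (use v assms params in auto)
qed

end

theorem mainTheorem5:
  fixes points :: "'a set" and blocks :: "'b set" and inc :: "'a \<Rightarrow> 'b \<Rightarrow> bool"
    and A :: "nat mat" and v k lam p :: nat
  assumes "3 \<le> p"
    and "sbibd points blocks inc v k lam"
    and "representative A points blocks inc v"
    and "zero_diagonal A"
    and "lam * (p - 1) + 1 \<le> k"
    and "\<not> (\<exists>F. pairwise_separated A F \<and> card F = p)"
  shows "(\<exists>q \<le> k. universal_count A k p q) \<and>
    max p (lam + 1) \<le> q_star A k p \<and> q_star A k p \<le> lam * (p - 1) + 1 \<and>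
    (lam = 1 \<longrightarrow> q_star A k p = p)"
proof -
  interpret incidence_matrix A v k lam
    using assms by (intro incidence_matrix_of_representative)
  let ?u = "lam * (p - 1) + 1"
  have u: "?u \<le> k \<and> universal_count A k p ?u"
    using assms universal_count_upper by blast
  have least: "q_star A k p \<le> k \<and> universal_count A k p (q_star A k p)"
    unfolding q_star_def using u by (rule LeastI)
  have upper: "q_star A k p \<le> ?u"
    unfolding q_star_def using u by (rule Least_le)
  have "p \<le> q_star A k p"
    using least not_universal_below_p not_less by blast
  moreover have "lam + 1 \<le> q_star A k p"
    using least not_universal_upto_lam[of "q_star A k p" p] assms(1) by linarith
  \<comment> \<open>For \<open>lam = 1\<close> the upper bound \<open>lam * (p - 1) + 1\<close>
    equals \<open>p\<close>.\<close>
  ultimately show ?thesis using u upper assms(1) by auto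
qed

end
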